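(* Consider the coflow-level coflow scheduling problem on $m$ identical parallel network cores, defined in the context below. Let CLS be the following algorithm. Initialize $load_I(i,h)=0$ and $load_O(j,h)=0$ for all input ports $i$, output ports $j$ and cores $h\in\{1,\dots,m\}$, and $\mathcal{A}_h=\emptyset$ for all $h$. For each coflow $k\in\mathcal{K}$, taken in an arbitrary order, let $h^*=\arg\min_{h}\max_{i\in\mathcal{I},\,j\in\mathcal{J}}\{load_I(i,h)+load_O(j,h)+L_{i,k}+L_{j,k}\}$; add $k$ to $\mathcal{A}_{h^*}$, and for all $i\in\mathcal{I}$, $j\in\mathcal{J}$ increase $load_I(i,h^* )$ by $L_{i,k}$ and $load_O(j,h^* )$ by $L_{j,k}$. Output the assignment $\{\mathcal{A}_h\}_{h=1}^m$ (all flows of every coflow in $\mathcal{A}_h$ are transmitted on core $h$). Then CLS is a $(2m)$-approximation algorithm: if $T$ is the makespan of the schedule found by CLS and $T^*$ is the optimal makespan, then $T\le 2mT^*$.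
   Context: Identical parallel networks: there are $m$ network cores, each a non-blocking $N\times N$ switch with input ports $\mathcal{I}=\{1,\dots,N\}$ and output ports $\mathcal{J}=\{1,\dots,N\}$; the $i$-th source server is connected to input port $i$ of every core and the $j$-th destination server to output port $j$ of every core. Every port of every core can transfer at most one unit of data per unit of time. A set $\mathcal{K}=\{1,\dots,K\}$ of coflows is given, all released at time $0$; coflow $k$ is an $N\times N$ matrix $D^{(k)}$ of nonnegative integers, and each nonzero entry $d_{i,j,k}$ is a flow $(i,j,k)$ that must transfer $d_{i,j,k}$ units of data from input port $i$ to output port $j$. $L_{i,k}=\sum_{j=1}^N d_{i,j,k}$ and $L_{j,k}=\sum_{i=1}^N d_{i,j,k}$. In the coflow-level scheduling problem, all flows of a given coflow must be transmitted through the same single core. The completion time $C_k$ of coflow $k$ is the time at which its last flow finishes, and the makespan is $\max_k C_k$; $T^*$ denotes the minimum makespan over all feasible coflow-level schedules. *)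

theory Defs
  imports "HOL-Analysis.Analysis"
begin

text \<open>
  An instance is given by \<open>N\<close> (ports are \<open>{1..N}\<close>), \<open>m\<close> (cores are \<open>{1..m}\<close>),
  \<open>K\<close> (coflows are \<open>{1..K}\<close>) and \<open>D\<close>, where \<open>D k i j\<close> is the number of units of data
  that coflow \<open>k\<close> has to send from input port \<open>i\<close> to output port \<open>j\<close>.
\<close>

type_synonym demand = "nat \<Rightarrow> nat \<Rightarrow> nat \<Rightarrow> nat"

definition L_in :: "nat \<Rightarrow> demand \<Rightarrow> nat \<Rightarrow> nat \<Rightarrow> nat" where
  "L_in N D i k = (\<Sum>j=1..N. D k i j)"

definition L_out :: "nat \<Rightarrow> demand \<Rightarrow> nat \<Rightarrow> nat \<Rightarrow> nat" where
  "L_out N D j k = (\<Sum>i=1..N. D k i j)"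


section \<open>Coflow-level schedules\<close>

text \<open>
  All flows of coflow \<open>k\<close> use the single core \<open>core \<sigma> k\<close>; \<open>rate \<sigma> k i j t\<close> is the rate at
  which flow \<open>(i, j, k)\<close> is transmitted on it at time \<open>t\<close>. Ports are only limited in their
  total rate, so preemptive and non-preemptive schedules, and those serving one flow per port
  at a time (rates in \<open>{0, 1}\<close>), are all instances.
\<close>

record schedule =
  core :: "nat \<Rightarrow> nat"
  rate :: "nat \<Rightarrow> nat \<Rightarrow> nat \<Rightarrow> real \<Rightarrow> real"

definition in_rate :: "nat \<Rightarrow> nat \<Rightarrow> schedule \<Rightarrow> nat \<Rightarrow> nat \<Rightarrow> real \<Rightarrow> real" where
  "in_rate N K \<sigma> h i t = (\<Sum>k | k \<in> {1..K} \<and> core \<sigma> k = h. \<Sum>j=1..N. rate \<sigma> k i j t)"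

definition out_rate :: "nat \<Rightarrow> nat \<Rightarrow> schedule \<Rightarrow> nat \<Rightarrow> nat \<Rightarrow> real \<Rightarrow> real" where
  "out_rate N K \<sigma> h j t = (\<Sum>k | k \<in> {1..K} \<and> core \<sigma> k = h. \<Sum>i=1..N. rate \<sigma> k i j t)"

definition transferred :: "schedule \<Rightarrow> nat \<Rightarrow> nat \<Rightarrow> nat \<Rightarrow> real \<Rightarrow> real" where
  "transferred \<sigma> k i j \<tau> = integral {0..\<tau>} (rate \<sigma> k i j)"

definition feasible :: "nat \<Rightarrow> nat \<Rightarrow> nat \<Rightarrow> demand \<Rightarrow> schedule \<Rightarrow> bool" where
  "feasible N m K D \<sigma> \<longleftrightarrow>
     (\<forall>k\<in>{1..K}. core \<sigma> k \<in> {1..m}) \<and>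
     (\<forall>k\<in>{1..K}. \<forall>i\<in>{1..N}. \<forall>j\<in>{1..N}.
        (\<forall>t\<ge>0. 0 \<le> rate \<sigma> k i j t) \<and>
        (\<forall>\<tau>\<ge>0. rate \<sigma> k i j integrable_on {0..\<tau>}) \<and>
        (\<forall>\<tau>\<ge>0. transferred \<sigma> k i j \<tau> \<le> real (D k i j)) \<and>
        (\<exists>\<tau>\<ge>0. transferred \<sigma> k i j \<tau> = real (D k i j))) \<and>
     (\<forall>h\<in>{1..m}. \<forall>p\<in>{1..N}. \<forall>t\<ge>0. in_rate N K \<sigma> h p t \<le> 1 \<and> out_rate N K \<sigma> h p t \<le> 1)"

text \<open>The completion time of an absent flow (\<open>D k i j = 0\<close>) is \<open>0\<close>.\<close>

definition flow_completion :: "demand \<Rightarrow> schedule \<Rightarrow> nat \<Rightarrow> nat \<Rightarrow> nat \<Rightarrow> real" where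
  "flow_completion D \<sigma> k i j = Inf {\<tau>. 0 \<le> \<tau> \<and> transferred \<sigma> k i j \<tau> = real (D k i j)}"

definition coflow_completion :: "nat \<Rightarrow> demand \<Rightarrow> schedule \<Rightarrow> nat \<Rightarrow> real" where
  "coflow_completion N D \<sigma> k = (MAX (i, j)\<in>{1..N} \<times> {1..N}. flow_completion D \<sigma> k i j)"

definition makespan :: "nat \<Rightarrow> nat \<Rightarrow> demand \<Rightarrow> schedule \<Rightarrow> real" where
  "makespan N K D \<sigma> = (MAX k\<in>{1..K}. coflow_completion N D \<sigma> k)"

definition optimal_makespan :: "nat \<Rightarrow> nat \<Rightarrow> nat \<Rightarrow> demand \<Rightarrow> real" where
  "optimal_makespan N m K D = Inf {makespan N K D \<sigma> | \<sigma>. feasible N m K D \<sigma>}"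


section \<open>The algorithm CLS\<close>

record cls_state =
  load_I :: "nat \<Rightarrow> nat \<Rightarrow> nat"
  load_O :: "nat \<Rightarrow> nat \<Rightarrow> nat"
  assigned :: "nat \<Rightarrow> nat set"

definition cls_init :: cls_state where
  "cls_init = \<lparr>load_I = (\<lambda>i h. 0), load_O = (\<lambda>j h. 0), assigned = (\<lambda>h. {})\<rparr>"

definition cls_cost :: "nat \<Rightarrow> demand \<Rightarrow> cls_state \<Rightarrow> nat \<Rightarrow> nat \<Rightarrow> nat" where
  "cls_cost N D s k h =
     (MAX (i, j)\<in>{1..N} \<times> {1..N}. load_I s i h + load_O s j h + L_in N D i k + L_out N D j k)"

definition cls_assign :: "nat \<Rightarrow> demand \<Rightarrow> nat \<Rightarrow> nat \<Rightarrow> cls_state \<Rightarrow> cls_state" where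
  "cls_assign N D k h s =
     \<lparr>load_I = (\<lambda>i h'. if h' = h then load_I s i h + L_in N D i k else load_I s i h'),
      load_O = (\<lambda>j h'. if h' = h then load_O s j h + L_out N D j k else load_O s j h'),
      assigned = (assigned s)(h := insert k (assigned s h))\<rparr>"

text \<open>A relation rather than a function, because ties in the arg min are broken arbitrarily.\<close>

inductive cls_run :: "nat \<Rightarrow> nat \<Rightarrow> demand \<Rightarrow> cls_state \<Rightarrow> nat list \<Rightarrow> cls_state \<Rightarrow> bool"
  for N m :: nat and D :: demand where
  Nil: "cls_run N m D s [] s"
| Cons: "is_arg_min (cls_cost N D s k) (\<lambda>h. h \<in> {1..m}) h \<Longrightarrow>
         cls_run N m D (cls_assign N D k h s) ks s' \<Longrightarrow>
         cls_run N m D s (k # ks) s'"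

definition cls_output :: "nat \<Rightarrow> nat \<Rightarrow> nat \<Rightarrow> demand \<Rightarrow> (nat \<Rightarrow> nat set) \<Rightarrow> bool" where
  "cls_output N m K D A \<longleftrightarrow>
     (\<exists>order s. distinct order \<and> set order = {1..K} \<and>
        cls_run N m D cls_init order s \<and> A = assigned s)"


section \<open>Schedules for a given assignment\<close>

text \<open>
  CLS only fixes the core of each coflow. Its schedule is completed within the cores either by
  any list schedule (\<open>work_conserving\<close>) or optimally (\<open>assignment_makespan\<close>).
\<close>

definition follows :: "nat \<Rightarrow> (nat \<Rightarrow> nat set) \<Rightarrow> schedule \<Rightarrow> bool" where
  "follows m A \<sigma> \<longleftrightarrow> (\<forall>h\<in>{1..m}. \<forall>k\<in>A h. core \<sigma> k = h)"

text \<open>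
  List schedules: as long as a flow is unfinished, its input port or its output port
  is fully used on the core to which the flow is assigned.
\<close>

definition work_conserving :: "nat \<Rightarrow> nat \<Rightarrow> demand \<Rightarrow> schedule \<Rightarrow> bool" where
  "work_conserving N K D \<sigma> \<longleftrightarrow>
     (\<forall>k\<in>{1..K}. \<forall>i\<in>{1..N}. \<forall>j\<in>{1..N}. \<forall>t\<ge>0.
        transferred \<sigma> k i j t < real (D k i j) \<longrightarrow>
        in_rate N K \<sigma> (core \<sigma> k) i t = 1 \<or> out_rate N K \<sigma> (core \<sigma> k) j t = 1)"

definition assignment_makespan ::
  "nat \<Rightarrow> nat \<Rightarrow> nat \<Rightarrow> demand \<Rightarrow> (nat \<Rightarrow> nat set) \<Rightarrow> real" where
  "assignment_makespan N m K D A =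
     Inf {makespan N K D \<sigma> | \<sigma>. feasible N m K D \<sigma> \<and> follows m A \<sigma>}"

end

theory Submission
  imports Defs
begin

text \<open>
  Everything rests on the total load \<open>\<Sum>k. L_in N D i k\<close> of a port over all cores: by time \<open>T\<close>
  the \<open>m\<close> copies of the port have moved at most \<open>m * T\<close> units, so it is at most \<open>m\<close> times the
  optimal makespan. While a flow \<open>(i, j, k)\<close> is unfinished in a list schedule, the two ports
  together move at least one unit per unit of time, so the flow is finished by the sum of the
  loads of its two ports. For the optimal completion of the assignment, the fluid schedule that
  serves all flows at constant rates finishes them within any bound on the port loads.
\<close>

section \<open>Feasible schedules and the data moved through their ports\<close>

definition core_coflows :: "nat \<Rightarrow> schedule \<Rightarrow> nat \<Rightarrow> nat set" where
  "core_coflows K \<sigma> h = {k. k \<in> {1..K} \<and> core \<sigma> k = h}"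

lemma finite_core_coflows [simp]: "finite (core_coflows K \<sigma> h)"
  by (simp add: core_coflows_def)

lemma core_coflows_subset: "core_coflows K \<sigma> h \<subseteq> {1..K}"
  by (auto simp: core_coflows_def)

lemma sum_core_coflows_le:
  fixes f :: "nat \<Rightarrow> nat"
  shows "sum f (core_coflows K \<sigma> h) \<le> sum f {1..K}"
  by (intro sum_mono2 core_coflows_subset) auto

lemma feasible_core: "feasible N m K D \<sigma> \<Longrightarrow> k \<in> {1..K} \<Longrightarrow> core \<sigma> k \<in> {1..m}"
  by (auto simp: feasible_def)

lemma feasible_flow:
  assumes "feasible N m K D \<sigma>" "k \<in> {1..K}" "i \<in> {1..N}" "j \<in> {1..N}"
  shows rate_nonneg: "\<And>t. t \<ge> 0 \<Longrightarrow> 0 \<le> rate \<sigma> k i j t"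
    and rate_integrable: "\<And>\<tau>. \<tau> \<ge> 0 \<Longrightarrow> rate \<sigma> k i j integrable_on {0..\<tau>}"
    and transferred_le: "\<And>\<tau>. \<tau> \<ge> 0 \<Longrightarrow> transferred \<sigma> k i j \<tau> \<le> real (D k i j)"
    and transferred_all: "\<exists>\<tau>\<ge>0. transferred \<sigma> k i j \<tau> = real (D k i j)"
  using assms unfolding feasible_def by blast+

lemma feasible_port:
  assumes "feasible N m K D \<sigma>" "h \<in> {1..m}" "p \<in> {1..N}" "t \<ge> 0"
  shows in_rate_le_1: "in_rate N K \<sigma> h p t \<le> 1"
    and out_rate_le_1: "out_rate N K \<sigma> h p t \<le> 1"
  using assms unfolding feasible_def by blast+

lemma transferred_mono:
  assumes "feasible N m K D \<sigma>" "k \<in> {1..K}" "i \<in> {1..N}" "j \<in> {1..N}" "0 \<le> s" "s \<le> t"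
  shows "transferred \<sigma> k i j s \<le> transferred \<sigma> k i j t"
  unfolding transferred_def
  using assms
  by (intro integral_subset_le rate_integrable[OF assms(1-4)] ballI rate_nonneg[OF assms(1-4)]) auto

text \<open>Integrating the rate of a port gives the data it has moved, so bounds on rates become
  bounds on data: capacity 1 limits the loads from above, and a busy port in a list schedule forces
  progress.\<close>

lemma in_rate_has_integral:
  assumes "feasible N m K D \<sigma>" "i \<in> {1..N}" "\<tau> \<ge> 0"
  shows "(in_rate N K \<sigma> h i has_integral
           (\<Sum>k\<in>core_coflows K \<sigma> h. \<Sum>j=1..N. transferred \<sigma> k i j \<tau>)) {0..\<tau>}"
proof -
  have "((\<lambda>t. \<Sum>k\<in>core_coflows K \<sigma> h. \<Sum>j=1..N. rate \<sigma> k i j t) has_integral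
           (\<Sum>k\<in>core_coflows K \<sigma> h. \<Sum>j=1..N. transferred \<sigma> k i j \<tau>)) {0..\<tau>}"
    unfolding transferred_def using assms core_coflows_subset[of K \<sigma> h]
    by (intro has_integral_sum integrable_integral rate_integrable[OF assms(1)]
        finite_core_coflows) auto
  then show ?thesis
    by (simp add: in_rate_def[abs_def] core_coflows_def)
qed

lemma out_rate_has_integral:
  assumes "feasible N m K D \<sigma>" "j \<in> {1..N}" "\<tau> \<ge> 0"
  shows "(out_rate N K \<sigma> h j has_integral
           (\<Sum>k\<in>core_coflows K \<sigma> h. \<Sum>i=1..N. transferred \<sigma> k i j \<tau>)) {0..\<tau>}"
proof -
  have "((\<lambda>t. \<Sum>k\<in>core_coflows K \<sigma> h. \<Sum>i=1..N. rate \<sigma> k i j t) has_integral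
           (\<Sum>k\<in>core_coflows K \<sigma> h. \<Sum>i=1..N. transferred \<sigma> k i j \<tau>)) {0..\<tau>}"
    unfolding transferred_def using assms core_coflows_subset[of K \<sigma> h]
    by (intro has_integral_sum integrable_integral rate_integrable[OF assms(1)]
        finite_core_coflows) auto
  then show ?thesis
    by (simp add: out_rate_def[abs_def] core_coflows_def)
qed

section \<open>Completion times and the makespan\<close>

lemma flow_completion_nonneg:
  assumes "feasible N m K D \<sigma>" "k \<in> {1..K}" "i \<in> {1..N}" "j \<in> {1..N}"
  shows "0 \<le> flow_completion D \<sigma> k i j"
  unfolding flow_completion_def
  using transferred_all[OF assms] by (intro cInf_greatest) auto

lemma flow_completion_le:
  assumes "0 \<le> \<tau>" "transferred \<sigma> k i j \<tau> = real (D k i j)"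
  shows "flow_completion D \<sigma> k i j \<le> \<tau>"
  unfolding flow_completion_def
  using assms by (intro cInf_lower bdd_belowI[of _ 0]) auto

text \<open>A completion time is an infimum. Strictly after it there is an earlier time
  \<open>s\<close> at which the flow is complete, so whether the infimum is attained does not
  matter. From \<open>s\<close> on, the amount can neither drop nor exceed the demand.\<close>

lemma transferred_after_completion:
  assumes "feasible N m K D \<sigma>" "k \<in> {1..K}" "i \<in> {1..N}" "j \<in> {1..N}"
    and "flow_completion D \<sigma> k i j < \<tau>"
  shows "transferred \<sigma> k i j \<tau> = real (D k i j)"
proof -
  let ?S = "{\<tau>. 0 \<le> \<tau> \<and> transferred \<sigma> k i j \<tau> = real (D k i j)}"
  have "?S \<noteq> {}" using transferred_all[OF assms(1-4)] by auto
  then obtain s where s: "0 \<le> s" "transferred \<sigma> k i j s = real (D k i j)" "s < \<tau>"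
    using cInf_lessD[of ?S \<tau>] assms(5) unfolding flow_completion_def by auto
  then show ?thesis
    using transferred_mono[OF assms(1-4), of s \<tau>] transferred_le[OF assms(1-4), of \<tau>] by auto
qed

text \<open>With \<open>N \<ge> 1\<close> and \<open>K \<ge> 1\<close> both maxima range over
  nonempty sets, so \<open>Max\<close> has its intended meaning.\<close>

lemma makespan_le_iff:
  assumes "N \<ge> 1" "K \<ge> 1"
  shows "makespan N K D \<sigma> \<le> B \<longleftrightarrow>
           (\<forall>k\<in>{1..K}. \<forall>i\<in>{1..N}. \<forall>j\<in>{1..N}. flow_completion D \<sigma> k i j \<le> B)"
  using assms unfolding makespan_def coflow_completion_def by (subst Max_le_iff) auto

lemma makespan_nonneg:
  assumes "feasible N m K D \<sigma>" "N \<ge> 1" "K \<ge> 1"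
  shows "0 \<le> makespan N K D \<sigma>"
proof -
  have "0 \<le> flow_completion D \<sigma> 1 1 1"
    using assms by (intro flow_completion_nonneg[OF assms(1)]) auto
  also have "\<dots> \<le> makespan N K D \<sigma>"
    using makespan_le_iff[OF assms(2,3), of D \<sigma> "makespan N K D \<sigma>"] assms by auto
  finally show ?thesis .
qed

section \<open>Port loads as lower bounds on the makespan\<close>

lemma core_load_le:
  assumes feas: "feasible N m K D \<sigma>" and h: "h \<in> {1..m}" and p: "p \<in> {1..N}"
    and "N \<ge> 1" "K \<ge> 1" and \<tau>: "makespan N K D \<sigma> < \<tau>"
  shows core_load_in_le: "real (\<Sum>k\<in>core_coflows K \<sigma> h. L_in N D p k) \<le> \<tau>"
    and core_load_out_le: "real (\<Sum>k\<in>core_coflows K \<sigma> h. L_out N D p k) \<le> \<tau>"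
proof -
  have \<tau>0: "\<tau> \<ge> 0" using makespan_nonneg[OF feas \<open>N \<ge> 1\<close> \<open>K \<ge> 1\<close>] \<tau> by simp
  \<comment> \<open>This is where the strict inequality between the makespan and
    \<open>\<tau>\<close> enters.\<close>
  have finished: "transferred \<sigma> k i j \<tau> = real (D k i j)"
    if "k \<in> {1..K}" "i \<in> {1..N}" "j \<in> {1..N}" for k i j
  proof (rule transferred_after_completion[OF feas that])
    show "flow_completion D \<sigma> k i j < \<tau>"
      using makespan_le_iff[OF \<open>N \<ge> 1\<close> \<open>K \<ge> 1\<close>, of D \<sigma> "makespan N K D \<sigma>"] that \<tau> by fastforce
  qed
  have unit: "((\<lambda>t::real. 1::real) has_integral \<tau>) {0..\<tau>}"
    using has_integral_const_real[of "1::real" 0 \<tau>] \<tau>0 by simp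
  have "(\<Sum>k\<in>core_coflows K \<sigma> h. \<Sum>j=1..N. transferred \<sigma> k p j \<tau>) \<le> \<tau>"
    by (rule has_integral_le[OF in_rate_has_integral[OF feas p \<tau>0] unit])
       (use feas h p in \<open>auto intro: in_rate_le_1\<close>)
  also have "(\<Sum>k\<in>core_coflows K \<sigma> h. \<Sum>j=1..N. transferred \<sigma> k p j \<tau>) =
             real (\<Sum>k\<in>core_coflows K \<sigma> h. L_in N D p k)"
    unfolding L_in_def of_nat_sum using core_coflows_subset[of K \<sigma> h] p
    by (intro sum.cong refl finished) auto
  finally show "real (\<Sum>k\<in>core_coflows K \<sigma> h. L_in N D p k) \<le> \<tau>" .
  have "(\<Sum>k\<in>core_coflows K \<sigma> h. \<Sum>i=1..N. transferred \<sigma> k i p \<tau>) \<le> \<tau>"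
    by (rule has_integral_le[OF out_rate_has_integral[OF feas p \<tau>0] unit])
       (use feas h p in \<open>auto intro: out_rate_le_1\<close>)
  also have "(\<Sum>k\<in>core_coflows K \<sigma> h. \<Sum>i=1..N. transferred \<sigma> k i p \<tau>) =
             real (\<Sum>k\<in>core_coflows K \<sigma> h. L_out N D p k)"
    unfolding L_out_def of_nat_sum using core_coflows_subset[of K \<sigma> h] p
    by (intro sum.cong refl finished) auto
  finally show "real (\<Sum>k\<in>core_coflows K \<sigma> h. L_out N D p k) \<le> \<tau>" .
qed

text \<open>The cores partition the coflows, so the total splits into \<open>m\<close> sums, one per
  core.\<close>

lemma sum_le_cores:
  fixes f :: "nat \<Rightarrow> nat"
  assumes "feasible N m K D \<sigma>"
    and "\<And>h. h \<in> {1..m} \<Longrightarrow> real (sum f (core_coflows K \<sigma> h)) \<le> \<tau>"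
  shows "real (sum f {1..K}) \<le> real m * \<tau>"
proof -
  have "(\<Sum>h\<in>{1..m}. sum f (core_coflows K \<sigma> h)) = sum f {1..K}"
    unfolding core_coflows_def
    by (rule sum.group) (use feasible_core[OF assms(1)] in auto)
  then have "real (sum f {1..K}) = (\<Sum>h\<in>{1..m}. real (sum f (core_coflows K \<sigma> h)))"
    by (metis of_nat_sum)
  also have "\<dots> \<le> (\<Sum>h\<in>{1..m}. \<tau>)"
    by (intro sum_mono assms(2))
  finally show ?thesis by simp
qed

lemma load_le_makespan:
  assumes "feasible N m K D \<sigma>" "p \<in> {1..N}" "N \<ge> 1" "m \<ge> 1" "K \<ge> 1"
  shows "real (\<Sum>k=1..K. L_in N D p k) / real m \<le> makespan N K D \<sigma>"
    and "real (\<Sum>k=1..K. L_out N D p k) / real m \<le> makespan N K D \<sigma>"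
proof -
  note core = core_load_le[OF assms(1) _ assms(2,3,5)]
  have *: "real (\<Sum>k=1..K. L_in N D p k) \<le> real m * \<tau>"
          "real (\<Sum>k=1..K. L_out N D p k) \<le> real m * \<tau>"
    if "makespan N K D \<sigma> < \<tau>" for \<tau>
    by (rule sum_le_cores[OF assms(1)], erule core, rule that)+
  \<comment> \<open>The bound holds for every \<open>\<tau>\<close> beyond the makespan; density of
    the reals carries it over to the makespan itself.\<close>
  show "real (\<Sum>k=1..K. L_in N D p k) / real m \<le> makespan N K D \<sigma>"
    by (rule dense_ge) (use * \<open>m \<ge> 1\<close> in \<open>simp add: divide_le_eq mult.commute\<close>)
  show "real (\<Sum>k=1..K. L_out N D p k) / real m \<le> makespan N K D \<sigma>"
    by (rule dense_ge) (use * \<open>m \<ge> 1\<close> in \<open>simp add: divide_le_eq mult.commute\<close>)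
qed

section \<open>The fluid schedule\<close>

text \<open>For \<open>W = 0\<close> all demands vanish, and so do the rates, since \<open>0 / 0 = 0\<close>.\<close>

definition fluid_schedule :: "demand \<Rightarrow> (nat \<Rightarrow> nat) \<Rightarrow> real \<Rightarrow> schedule" where
  "fluid_schedule D c W =
     \<lparr>core = c, rate = (\<lambda>k i j t. if t \<in> {0..W} then real (D k i j) / W else 0)\<rparr>"

lemma fluid_transferred:
  assumes "\<tau> \<ge> 0"
  shows "rate (fluid_schedule D c W) k i j integrable_on {0..\<tau>}"
    and "transferred (fluid_schedule D c W) k i j \<tau> = max 0 (min \<tau> W) * (real (D k i j) / W)"
proof -
  \<comment> \<open>The \<open>max 0\<close> covers negative \<open>W\<close>: the interval is then
    empty and the integral is 0.\<close>
  have "((\<lambda>t. real (D k i j) / W) has_integral max 0 (min \<tau> W) * (real (D k i j) / W))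
          {0..min \<tau> W}"
    using has_integral_const_real[of "real (D k i j) / W" 0 "min \<tau> W"]
    by (simp add: max_def min_def split: if_splits)
  moreover have "{0..min \<tau> W} = {0..W} \<inter> {0..\<tau>}" by auto
  ultimately have "((\<lambda>t. if t \<in> {0..W} then real (D k i j) / W else 0) has_integral
      max 0 (min \<tau> W) * (real (D k i j) / W)) {0..\<tau>}"
    by (simp only: has_integral_restrict_Int)
  then show "rate (fluid_schedule D c W) k i j integrable_on {0..\<tau>}"
    and "transferred (fluid_schedule D c W) k i j \<tau> = max 0 (min \<tau> W) * (real (D k i j) / W)"
    by (auto simp: fluid_schedule_def transferred_def integral_unique
             simp del: atLeastAtMost_iff intro: has_integral_integrable)
qed

text \<open>Every flow sends the fraction \<open>1 / W\<close> of its demand per unit of time, so a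
  port of any core is used at its load there divided by \<open>W\<close>. Since \<open>W\<close>
  bounds the load summed over all cores, this works for every choice of \<open>c\<close>.\<close>

lemma fluid_schedule_feasible:
  assumes c: "\<And>k. k \<in> {1..K} \<Longrightarrow> c k \<in> {1..m}" and W: "W \<ge> 0"
    and W_in: "\<And>p. p \<in> {1..N} \<Longrightarrow> real (\<Sum>k=1..K. L_in N D p k) \<le> W"
    and W_out: "\<And>p. p \<in> {1..N} \<Longrightarrow> real (\<Sum>k=1..K. L_out N D p k) \<le> W"
    and "N \<ge> 1" "K \<ge> 1"
  shows "feasible N m K D (fluid_schedule D c W)"
    and "makespan N K D (fluid_schedule D c W) \<le> W"
proof -
  let ?\<sigma> = "fluid_schedule D c W"
  \<comment> \<open>For \<open>W = 0\<close> nothing is ever sent, so the schedule is complete only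
    because the load bound forces every demand to be 0.\<close>
  have zero: "D k i j = 0" if "k \<in> {1..K}" "i \<in> {1..N}" "j \<in> {1..N}" "W = 0" for k i j
  proof -
    have "(\<Sum>k=1..K. \<Sum>j=1..N. D k i j) = 0"
      using W_in[OF that(2)] that(4) by (simp add: L_in_def del: of_nat_sum)
    then show ?thesis using that by simp
  qed
  have final: "transferred ?\<sigma> k i j W = real (D k i j)"
    if "k \<in> {1..K}" "i \<in> {1..N}" "j \<in> {1..N}" for k i j
    using fluid_transferred(2)[OF W, of D c W k i j] zero[OF that] W by (cases "W = 0") auto
  have le: "transferred ?\<sigma> k i j \<tau> \<le> real (D k i j)" if "\<tau> \<ge> 0" for \<tau> k i j
  proof (cases "W = 0")
    case False
    have "max 0 (min \<tau> W) * (real (D k i j) / W) \<le> W * (real (D k i j) / W)"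
      using W by (intro mult_right_mono) auto
    then show ?thesis using fluid_transferred(2)[OF that, of D c W k i j] False by simp
  qed (use fluid_transferred(2)[OF that] in auto)
  have in_le: "in_rate N K ?\<sigma> h p t \<le> 1" if "p \<in> {1..N}" for h p t
  proof (cases "t \<in> {0..W}")
    case True
    have "in_rate N K ?\<sigma> h p t = real (\<Sum>k\<in>core_coflows K ?\<sigma> h. L_in N D p k) / W"
      using True by (simp add: in_rate_def core_coflows_def fluid_schedule_def L_in_def
          sum_divide_distrib)
    also have "\<dots> \<le> real (\<Sum>k=1..K. L_in N D p k) / W"
      using W by (intro divide_right_mono of_nat_mono sum_core_coflows_le)
    also have "\<dots> \<le> 1" using W_in[OF that] W by (simp add: divide_le_eq)
    finally show ?thesis .
  qed (auto simp: in_rate_def fluid_schedule_def)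
  have out_le: "out_rate N K ?\<sigma> h p t \<le> 1" if "p \<in> {1..N}" for h p t
  proof (cases "t \<in> {0..W}")
    case True
    have "out_rate N K ?\<sigma> h p t = real (\<Sum>k\<in>core_coflows K ?\<sigma> h. L_out N D p k) / W"
      using True by (simp add: out_rate_def core_coflows_def fluid_schedule_def L_out_def
          sum_divide_distrib)
    also have "\<dots> \<le> real (\<Sum>k=1..K. L_out N D p k) / W"
      using W by (intro divide_right_mono of_nat_mono sum_core_coflows_le)
    also have "\<dots> \<le> 1" using W_out[OF that] W by (simp add: divide_le_eq)
    finally show ?thesis .
  qed (auto simp: out_rate_def fluid_schedule_def)
  have "core ?\<sigma> k \<in> {1..m}" if "k \<in> {1..K}" for k
    using c[OF that] by (simp add: fluid_schedule_def)
  moreover have "0 \<le> rate ?\<sigma> k i j t" for k i j t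
    using W by (simp add: fluid_schedule_def)
  ultimately show "feasible N m K D ?\<sigma>"
    unfolding feasible_def using in_le out_le le final W fluid_transferred(1)
    by (intro conjI ballI allI impI exI[of _ W]) assumption+
  show "makespan N K D ?\<sigma> \<le> W"
    unfolding makespan_le_iff[OF \<open>N \<ge> 1\<close> \<open>K \<ge> 1\<close>]
    using final W by (auto intro: flow_completion_le)
qed

text \<open>Makes the set in \<open>optimal_makespan\<close> nonempty, so that its
  \<open>Inf\<close> can be bounded from below.\<close>

lemma exists_feasible:
  assumes "N \<ge> 1" "m \<ge> 1" "K \<ge> 1"
  shows "\<exists>\<sigma>. feasible N m K D \<sigma>"
proof -
  \<comment> \<open>The sum of all port loads is a crude common bound on each of them.\<close>
  define W where
    "W = (\<Sum>p=1..N. (\<Sum>k=1..K. L_in N D p k) + (\<Sum>k=1..K. L_out N D p k))"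
  have le: "(\<Sum>k=1..K. L_in N D p k) + (\<Sum>k=1..K. L_out N D p k) \<le> W" if "p \<in> {1..N}" for p
    unfolding W_def by (rule member_le_sum[OF that]) auto
  have "feasible N m K D (fluid_schedule D (\<lambda>_. 1) (real W))"
  proof (rule fluid_schedule_feasible(1))
    fix p assume "p \<in> {1..N}"
    from le[OF this] show "real (\<Sum>k=1..K. L_in N D p k) \<le> real W"
      and "real (\<Sum>k=1..K. L_out N D p k) \<le> real W"
      by (metis add_leD1 of_nat_mono) (metis add_leD2 le of_nat_mono \<open>p \<in> {1..N}\<close>)
  qed (use assms in auto)
  then show ?thesis by blast
qed

lemma load_le_optimal:
  assumes "p \<in> {1..N}" "N \<ge> 1" "m \<ge> 1" "K \<ge> 1"
  shows "real (\<Sum>k=1..K. L_in N D p k) \<le> real m * optimal_makespan N m K D"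
    and "real (\<Sum>k=1..K. L_out N D p k) \<le> real m * optimal_makespan N m K D"
proof -
  \<comment> \<open>Division by \<open>m\<close> isolates the makespan, so the bound for each
    schedule passes to the infimum.\<close>
  have "real (\<Sum>k=1..K. L_in N D p k) / real m \<le> optimal_makespan N m K D"
    unfolding optimal_makespan_def
    using exists_feasible[OF assms(2-)] load_le_makespan(1)[OF _ assms]
    by (intro cInf_greatest) auto
  then show "real (\<Sum>k=1..K. L_in N D p k) \<le> real m * optimal_makespan N m K D"
    using \<open>m \<ge> 1\<close> by (simp add: divide_le_eq mult.commute)
  have "real (\<Sum>k=1..K. L_out N D p k) / real m \<le> optimal_makespan N m K D"
    unfolding optimal_makespan_def
    using exists_feasible[OF assms(2-)] load_le_makespan(2)[OF _ assms]
    by (intro cInf_greatest) auto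
  then show "real (\<Sum>k=1..K. L_out N D p k) \<le> real m * optimal_makespan N m K D"
    using \<open>m \<ge> 1\<close> by (simp add: divide_le_eq mult.commute)
qed

section \<open>List schedules\<close>

lemma work_conserving_flow_completion_le:
  assumes feas: "feasible N m K D \<sigma>" and wc: "work_conserving N K D \<sigma>"
    and kij: "k \<in> {1..K}" "i \<in> {1..N}" "j \<in> {1..N}"
  shows "flow_completion D \<sigma> k i j \<le>
           real (\<Sum>k\<in>core_coflows K \<sigma> (core \<sigma> k). L_in N D i k) +
           real (\<Sum>k\<in>core_coflows K \<sigma> (core \<sigma> k). L_out N D j k)" (is "_ \<le> ?I + ?O")
proof (rule ccontr)
  let ?h = "core \<sigma> k"
  assume "\<not> ?thesis"
  \<comment> \<open>Any \<open>t\<close> strictly between the two loads together and the completion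
    time: the flow is then unfinished on all of \<open>{0..t}\<close>, the endpoint
    included.\<close>
  then obtain t where t: "?I + ?O < t" "t < flow_completion D \<sigma> k i j"
    using dense not_le by metis
  then have t0: "t \<ge> 0" by (smt (verit) of_nat_0_le_iff)
  have ge: "1 \<le> in_rate N K \<sigma> ?h i s + out_rate N K \<sigma> ?h j s" if s: "s \<in> {0..t}" for s
  proof -
    have "transferred \<sigma> k i j s < real (D k i j)"
      using transferred_le[OF feas kij, of s] flow_completion_le[of s \<sigma> k i j D] s t by fastforce
    then have "in_rate N K \<sigma> ?h i s = 1 \<or> out_rate N K \<sigma> ?h j s = 1"
      using wc kij s unfolding work_conserving_def by auto
    moreover have "0 \<le> in_rate N K \<sigma> ?h i s" "0 \<le> out_rate N K \<sigma> ?h j s"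
      unfolding in_rate_def out_rate_def using s kij
      by (auto intro!: sum_nonneg rate_nonneg[OF feas])
    ultimately show ?thesis by auto
  qed
  have "t \<le> (\<Sum>k\<in>core_coflows K \<sigma> ?h. \<Sum>j=1..N. transferred \<sigma> k i j t) +
            (\<Sum>k\<in>core_coflows K \<sigma> ?h. \<Sum>i=1..N. transferred \<sigma> k i j t)"
  proof (rule has_integral_le)
    show "((\<lambda>t::real. 1::real) has_integral t) {0..t}"
      using has_integral_const_real[of "1::real" 0 t] t0 by simp
    show "((\<lambda>s. in_rate N K \<sigma> ?h i s + out_rate N K \<sigma> ?h j s) has_integral
        (\<Sum>k\<in>core_coflows K \<sigma> ?h. \<Sum>j=1..N. transferred \<sigma> k i j t) +
        (\<Sum>k\<in>core_coflows K \<sigma> ?h. \<Sum>i=1..N. transferred \<sigma> k i j t)) {0..t}"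
      by (intro has_integral_add in_rate_has_integral[OF feas] out_rate_has_integral[OF feas]
          kij t0)
  qed (use ge in auto)
  \<comment> \<open>The data moved by time \<open>t\<close> cannot exceed the demands. A flow using
    both ports is counted twice on both sides.\<close>
  also have "\<dots> \<le> ?I + ?O"
    unfolding L_in_def L_out_def of_nat_sum using core_coflows_subset[of K \<sigma> ?h] kij t0
    by (intro add_mono sum_mono transferred_le[OF feas]) auto
  finally show False using t by simp
qed

section \<open>The assignment produced by CLS\<close>

lemma cls_run_assigned:
  assumes "cls_run N m D s ks s'" "distinct ks"
  shows "\<exists>c. (\<forall>k\<in>set ks. c k \<in> {1..m}) \<and>
             (\<forall>h. assigned s' h = assigned s h \<union> {k\<in>set ks. c k = h})"
  using assms
proof (induction rule: cls_run.induct)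
  case (Nil s)
  then show ?case by simp
next
  case (Cons s k h ks s')
  then obtain c where "\<forall>k\<in>set ks. c k \<in> {1..m}"
    "\<forall>h'. assigned s' h' = assigned (cls_assign N D k h s) h' \<union> {k\<in>set ks. c k = h'}"
    by auto
  moreover have "h \<in> {1..m}" using Cons.hyps(1) by (simp add: is_arg_min_def)
  ultimately show ?case
    \<comment> \<open>As \<open>k\<close> does not recur in \<open>ks\<close>, updating
      \<open>c\<close> at \<open>k\<close> leaves the cores of the later coflows unchanged.\<close>
    using Cons.prems by (intro exI[of _ "c(k := h)"]) (auto simp: cls_assign_def split: if_splits)
qed

lemma cls_output_core:
  assumes "cls_output N m K D A"
  obtains c where "\<And>k. k \<in> {1..K} \<Longrightarrow> c k \<in> {1..m}" "\<And>h. A h = {k\<in>{1..K}. c k = h}"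
proof -
  obtain order s where "distinct order" "set order = {1..K}" "cls_run N m D cls_init order s"
    "A = assigned s"
    using assms unfolding cls_output_def by blast
  then obtain c where "\<forall>k\<in>{1..K}. c k \<in> {1..m}" "\<forall>h. A h = {k\<in>{1..K}. c k = h}"
    using cls_run_assigned[of N m D cls_init order s] by (auto simp: cls_init_def)
  then show thesis using that by blast
qed

theorem theorem3:
  fixes N m K :: nat and D :: demand and A :: "nat \<Rightarrow> nat set"
  assumes "N \<ge> 1" and "m \<ge> 1" and "K \<ge> 1"
    and "cls_output N m K D A"
  shows "(\<forall>\<sigma>. feasible N m K D \<sigma> \<and> follows m A \<sigma> \<and> work_conserving N K D \<sigma> \<longrightarrow>
            makespan N K D \<sigma> \<le> 2 * real m * optimal_makespan N m K D) \<and>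
         assignment_makespan N m K D A \<le> 2 * real m * optimal_makespan N m K D"
proof (intro conjI allI impI)
  let ?T = "real m * optimal_makespan N m K D"
  note load = load_le_optimal[OF _ assms(1-3), where D = D]
  fix \<sigma> assume \<sigma>: "feasible N m K D \<sigma> \<and> follows m A \<sigma> \<and> work_conserving N K D \<sigma>"
  have "flow_completion D \<sigma> k i j \<le> 2 * ?T"
    if kij: "k \<in> {1..K}" "i \<in> {1..N}" "j \<in> {1..N}" for k i j
  proof -
    have "flow_completion D \<sigma> k i j \<le>
        real (\<Sum>k\<in>core_coflows K \<sigma> (core \<sigma> k). L_in N D i k) +
        real (\<Sum>k\<in>core_coflows K \<sigma> (core \<sigma> k). L_out N D j k)"
      using \<sigma> kij by (intro work_conserving_flow_completion_le) auto
    \<comment> \<open>Passing from one core to all cores makes the bound independent of the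
      assignment; the factor \<open>m\<close> comes from the total loads.\<close>
    also have "\<dots> \<le> real (\<Sum>k=1..K. L_in N D i k) + real (\<Sum>k=1..K. L_out N D j k)"
      by (intro add_mono of_nat_mono sum_core_coflows_le)
    also have "\<dots> \<le> 2 * ?T" using load(1)[OF kij(2)] load(2)[OF kij(3)] by linarith
    finally show ?thesis .
  qed
  then show "makespan N K D \<sigma> \<le> 2 * real m * optimal_makespan N m K D"
    unfolding makespan_le_iff[OF assms(1,3)] by (simp add: mult.assoc)
next
  let ?T = "real m * optimal_makespan N m K D"
  note load = load_le_optimal[OF _ assms(1-3), where D = D]
  obtain c where c: "\<And>k. k \<in> {1..K} \<Longrightarrow> c k \<in> {1..m}" "\<And>h. A h = {k\<in>{1..K}. c k = h}"
    using cls_output_core[OF assms(4)] by blast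
  \<comment> \<open>Any port load shows \<open>?T\<close> to be nonnegative, as the fluid schedule
    requires of its duration.\<close>
  have "0 \<le> real (\<Sum>k=1..K. L_in N D 1 k)" by (rule of_nat_0_le_iff)
  also have "\<dots> \<le> ?T" using load(1)[of 1] \<open>N \<ge> 1\<close> by simp
  finally have T: "0 \<le> ?T" .
  \<comment> \<open>\<open>?T\<close> dominates the total load of every port, so a fluid schedule of
    this duration completes the assignment of CLS.\<close>
  let ?\<sigma> = "fluid_schedule D c ?T"
  note fluid = fluid_schedule_feasible[OF c(1) T load assms(1,3)]
  have "follows m A ?\<sigma>" by (simp add: follows_def c(2) fluid_schedule_def)
  then have "assignment_makespan N m K D A \<le> makespan N K D ?\<sigma>"
    unfolding assignment_makespan_def using fluid(1) assms
    by (intro cInf_lower bdd_belowI[of _ 0]) (auto intro: makespan_nonneg)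
  also have "\<dots> \<le> ?T" by (rule fluid(2))
  also have "\<dots> \<le> 2 * real m * optimal_makespan N m K D" using T by simp
  finally show "assignment_makespan N m K D A \<le> 2 * real m * optimal_makespan N m K D" .
qed

end
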